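(* Let $k\in\mathbb{N}_+$. A vector $\underline{\lambda}\in\mathbb{R}_+^k$ is fully supercritical if and only if $f^*_\infty(\underline{\lambda})>0$.
   Context: Notation: $\mathbb{N}_+=\{1,2,\dots\}$, $\mathbb{R}_+=(0,\infty)$, $[k]=\{1,\dots,k\}$. For $\underline{\lambda}=(\lambda_1,\dots,\lambda_k)\in\mathbb{R}_+^k$ let $\lambda^{\setminus i}=\sum_{j\in[k]\setminus\{i\}}\lambda_j$. The vector $\underline{\lambda}$ is fully supercritical if $\lambda^{\setminus i}>1$ for all $i\in[k]$. ECBP trees. $G_\infty=G_\infty(r)\sim\mathcal{G}_\infty(\underline{\lambda})$ denotes the random (possibly infinite) edge-colored tree with root $r$ generated recursively: given the tree up to generation $d$, each vertex $v$ in generation $d$ has $X_{v,i}\sim\mathrm{POI}(\lambda_i)$ children joined to it by an edge of color $i$ ($i\in[k]$), all these variables being conditionally independent. Write $v\stackrel{G_\infty^{\setminus i}}{\longleftrightarrow}w$ if the path between $v$ and $w$ contains no edge of color $i$, and $v\stackrel{G_\infty^{\setminus i}}{\longleftrightarrow}\infty$ if there is an infinite path starting at $v$ without edges of color $i$ all of whose vertices are descendants of $v$. The root $r$ and $v$ are $i$-avoiding friends if either $r\stackrel{G_\infty^{\setminus i}}{\longleftrightarrow}v$, or both $r\stackrel{G_\infty^{\setminus i}}{\longleftrightarrow}\infty$ and $v\stackrel{G_\infty^{\setminus i}}{\longleftrightarrow}\infty$. They are friends if they are $i$-avoiding friends for all $i\in[k]$. $\widetilde{\mathcal{C}}^*(r)$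 is the set of friends of $r$ (it contains $r$), and $f^*_\infty(\underline{\lambda})=\mathbb{P}(|\widetilde{\mathcal{C}}^*(r)|=\infty)$. *)

theory Defs
  imports "HOL-Probability.Probability" "HOL-Library.Sublist"
begin

text \<open>
  Colors are the elements of a finite type \<open>'k\<close>, so \<open>k = CARD('k)\<close>, and a vector of
  \<open>\<real>\<^sup>k\<close> has type \<open>real ^ 'k\<close>.
\<close>

definition fully_supercritical :: "real ^ 'k \<Rightarrow> bool" where
  "fully_supercritical lam \<longleftrightarrow> (\<forall>i. (\<Sum>j\<in>UNIV - {i}. lam $ j) > 1)"

text \<open>
  Vertices are Ulam--Harris words with the most recent letter first: \<open>[]\<close> is the root and
  \<open>(i, m) # v\<close> is the \<open>m\<close>-th (counting from 0) child of \<open>v\<close> along an edge of color \<open>i\<close>.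
  A configuration \<open>X\<close> gives the number \<open>X (v, i)\<close> of color-\<open>i\<close> children of every potential
  vertex \<open>v\<close>; the values at words outside the tree play no role.
\<close>

type_synonym 'k vertex = "('k \<times> nat) list"
type_synonym 'k config = "'k vertex \<times> 'k \<Rightarrow> nat"

fun in_tree :: "'k config \<Rightarrow> 'k vertex \<Rightarrow> bool" where
  "in_tree X [] \<longleftrightarrow> True"
| "in_tree X ((i, m) # v) \<longleftrightarrow> in_tree X v \<and> m < X (v, i)"

definition tree_edge :: "'k config \<Rightarrow> 'k \<Rightarrow> 'k vertex \<Rightarrow> 'k vertex \<Rightarrow> bool" where
  "tree_edge X c u w \<longleftrightarrow>
     in_tree X u \<and> in_tree X w \<and> (\<exists>m. w = (c, m) # u \<or> u = (c, m) # w)"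

definition avoiding_edge :: "'k config \<Rightarrow> 'k \<Rightarrow> 'k vertex \<Rightarrow> 'k vertex \<Rightarrow> bool" where
  "avoiding_edge X i u w \<longleftrightarrow> (\<exists>c. c \<noteq> i \<and> tree_edge X c u w)"

text \<open>
  In a tree the path between two vertices is unique, and every edge has exactly one color, so
  ``the path has no edge of color \<open>i\<close>'' is the existence of a path all of whose edges have a
  color different from \<open>i\<close>.
\<close>

definition avoiding_connected :: "'k config \<Rightarrow> 'k \<Rightarrow> 'k vertex \<Rightarrow> 'k vertex \<Rightarrow> bool" where
  "avoiding_connected X i v w \<longleftrightarrow>
     (\<exists>p. p \<noteq> [] \<and> hd p = v \<and> last p = w \<and> distinct p \<and> set p \<subseteq> Collect (in_tree X) \<and>
          successively (avoiding_edge X i) p)"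

text \<open>
  As words grow at the front, \<open>w\<close> is a descendant of \<open>v\<close> (or \<open>v\<close> itself) iff \<open>suffix v w\<close>.
\<close>

definition avoiding_infinity :: "'k config \<Rightarrow> 'k \<Rightarrow> 'k vertex \<Rightarrow> bool" where
  "avoiding_infinity X i v \<longleftrightarrow>
     (\<exists>p :: nat \<Rightarrow> 'k vertex. p 0 = v \<and> inj p \<and>
        (\<forall>n. suffix v (p n)) \<and> (\<forall>n. avoiding_edge X i (p n) (p (Suc n))))"

definition avoiding_friend :: "'k config \<Rightarrow> 'k \<Rightarrow> 'k vertex \<Rightarrow> bool" where
  "avoiding_friend X i v \<longleftrightarrow>
     avoiding_connected X i [] v \<or> (avoiding_infinity X i [] \<and> avoiding_infinity X i v)"

definition friends_of_root :: "'k config \<Rightarrow> 'k vertex set" where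
  "friends_of_root X = {v. in_tree X v \<and> (\<forall>i. avoiding_friend X i v)}"

text \<open>
  Independent Poisson offspring numbers are attached to all potential vertices. Those attached
  to the vertices of generation \<open>d\<close> are then independent of the tree up to generation \<open>d\<close>,
  which is the recursive description of the branching process.
\<close>

definition ecbp :: "real ^ 'k \<Rightarrow> 'k config measure" where
  "ecbp lam = Pi\<^sub>M UNIV (\<lambda>(v, i). measure_pmf (poisson_pmf (lam $ i)))"

text \<open>
  The event is measurable: offspring numbers are finite, so by Koenig's lemma \<open>avoiding_infinity\<close>
  amounts to having avoiding descendants in every later generation.
\<close>

definition f_star_infinity :: "real ^ 'k \<Rightarrow> real" where
  "f_star_infinity lam =
     measure (ecbp lam) {X \<in> space (ecbp lam). infinite (friends_of_root X)}"

end

theory Submission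
  imports Defs
begin

text \<open>
  Ignoring all edges of color \<open>i\<close> turns the tree into a Galton--Watson tree whose offspring
  distribution is Poisson with mean \<open>m\<close>, the sum of the rates of the other colors. Its extinction
  probabilities satisfy \<open>q (n + 1) = exp (m * (q n - 1))\<close>, so it survives with positive probability
  iff \<open>m > 1\<close> (\<open>survives_pos_if_supercritical\<close> and \<open>survives_null_if_not_supercritical\<close>).

  If \<open>m \<le> 1\<close> for some color \<open>i\<close>, then almost surely color \<open>i\<close> cannot be avoided forever from the
  root. All friends of the root are then reached from it without using color \<open>i\<close>, and they are
  finitely many (\<open>finite_friends_if_not_survives\<close>).

  If \<open>m > 1\<close> for every color, call a vertex immortal if each color can be avoided forever below it.
  An immortal root is a friend of every immortal vertex. The root is immortal with positive
  probability, since different children can take care of different colors and their subtrees are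
  independent (\<open>prob_all_survive_and_child\<close>). For every \<open>n\<close>, the first vertex of generation \<open>n\<close>, if
  there is one, is immortal with the same probability, since its subtree is independent of the
  generations before it (\<open>prob_vertex_in_generation\<close>). Placing such a vertex below one more child
  of the root shows that an immortal root coexists with an immortal vertex in generation \<open>n + 1\<close>
  with a probability at least \<open>c > 0\<close>, uniformly in \<open>n\<close>. Hence with probability at least \<open>c\<close> this
  happens for infinitely many \<open>n\<close>, and the root then has infinitely many friends.
\<close>

section \<open>Independence and self-similarity of the offspring numbers\<close>

text \<open>
  The tree of descendants of \<open>v\<close>, re-rooted at \<open>v\<close>: words grow at the front, so the descendants
  of \<open>v\<close> are the words \<open>w @ v\<close>.
\<close>

definition subtree :: "'k vertex \<Rightarrow> 'k config \<Rightarrow> 'k config" where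
  "subtree v X = (\<lambda>(w, c). X (w @ v, c))"

text \<open>
  Events that depend on disjoint sets of coordinates of a product measure are independent. Stating
  the dependence pointwise, and not through generated \<open>\<sigma>\<close>-algebras, turns every independence
  claim about the tree into a combinatorial check.
\<close>

definition determined_by :: "'a set \<Rightarrow> (('a \<Rightarrow> 'b) \<Rightarrow> bool) \<Rightarrow> bool" where
  "determined_by K P \<longleftrightarrow> (\<forall>X Y. (\<forall>p\<in>K. X p = Y p) \<longrightarrow> P X = P Y)"

abbreviation offspring_law :: "real ^ 'k \<Rightarrow> 'k vertex \<times> 'k \<Rightarrow> nat measure" where
  "offspring_law lam p \<equiv> measure_pmf (poisson_pmf (lam $ snd p))"

lemma ecbp_eq: "ecbp lam = Pi\<^sub>M UNIV (offspring_law lam)"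
  unfolding ecbp_def by (rule arg_cong[where f = "Pi\<^sub>M UNIV"]) auto

lemma prob_space_ecbp: "prob_space (ecbp lam)"
  unfolding ecbp_eq by (intro prob_space_PiM prob_space_measure_pmf)

lemma space_ecbp [simp]: "space (ecbp lam) = UNIV"
  unfolding ecbp_eq by (simp add: space_PiM)

lemma measurable_offspring [measurable]:
  "(\<lambda>X. X p) \<in> ecbp lam \<rightarrow>\<^sub>M count_space UNIV"
proof -
  have "(\<lambda>X. X p) \<in> ecbp lam \<rightarrow>\<^sub>M offspring_law lam p"
    unfolding ecbp_eq by (rule measurable_component_singleton) simp
  then show ?thesis by simp
qed

lemma sets_ecbp_iff: "{X. P X} \<in> sets (ecbp lam) \<longleftrightarrow> Measurable.pred (ecbp lam) P"
  by (simp add: pred_def)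

lemma distr_offspring: "distr (ecbp lam) (offspring_law lam p) (\<lambda>X. X p) = offspring_law lam p"
  unfolding ecbp_eq by (rule distr_PiM_component) (auto intro: prob_space_measure_pmf)

lemma prob_offspring:
  assumes "lam $ snd p > 0"
  shows "measure (ecbp lam) {X. X p = n} = pmf (poisson_pmf (lam $ snd p)) n"
proof -
  have "measure (offspring_law lam p) {n}
      = measure (distr (ecbp lam) (offspring_law lam p) (\<lambda>X. X p)) {n}"
    by (simp only: distr_offspring)
  also have "\<dots> = measure (ecbp lam) {X. X p = n}"
    by (subst measure_distr) (auto simp: vimage_def)
  finally show ?thesis by (simp add: measure_pmf_single)
qed

lemma distr_subtree: "distr (ecbp lam) (ecbp lam) (subtree v) = ecbp lam"
proof -
  let ?f = "\<lambda>(w, c). (w @ v, c)"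
  have "offspring_law lam (?f p) = offspring_law lam p" for p
    by (cases p) simp
  moreover have "subtree v = (\<lambda>X. \<lambda>p\<in>UNIV. X (?f p))"
    by (auto simp: subtree_def fun_eq_iff)
  ultimately show ?thesis
    using distr_PiM_reindex[of UNIV "offspring_law lam" ?f UNIV]
    by (auto simp: ecbp_eq inj_on_def prob_space_measure_pmf)
qed

lemma measurable_subtree [measurable]: "subtree v \<in> ecbp lam \<rightarrow>\<^sub>M ecbp lam"
proof -
  have "(\<lambda>X. \<lambda>p\<in>UNIV. X ((\<lambda>(w, c). (w @ v, c)) p)) \<in> ecbp lam \<rightarrow>\<^sub>M ecbp lam"
    unfolding ecbp_eq
    by (rule measurable_restrict) (auto simp flip: ecbp_eq)
  moreover have "subtree v = (\<lambda>X. \<lambda>p\<in>UNIV. X ((\<lambda>(w, c). (w @ v, c)) p))"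
    by (auto simp: subtree_def fun_eq_iff)
  ultimately show ?thesis by simp
qed

text \<open>
  Self-similarity: the offspring numbers below \<open>v\<close> are again a family of independent Poisson
  variables with the same rates, because \<open>(w, c) \<mapsto> (w @ v, c)\<close> is injective and keeps the color.
\<close>

lemma prob_subtree:
  assumes "Measurable.pred (ecbp lam) P"
  shows "measure (ecbp lam) {X. P (subtree v X)} = measure (ecbp lam) {X. P X}"
proof -
  have "measure (ecbp lam) {X. P X} = measure (distr (ecbp lam) (ecbp lam) (subtree v)) {X. P X}"
    by (simp add: distr_subtree)
  also have "\<dots> = measure (ecbp lam) {X. P (subtree v X)}"
    using assms by (subst measure_distr) (auto simp: sets_ecbp_iff vimage_def)
  finally show ?thesis by simp
qed

text \<open>
  An event determined by the coordinates in \<open>K j\<close> is the preimage, under restriction to \<open>K j\<close>, of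
  a measurable event on those coordinates: fill up the missing coordinates by \<open>0\<close> and apply the
  original predicate. Restrictions of a product measure to disjoint sets of coordinates are
  independent.
\<close>

lemma prob_Ball_disjoint:
  assumes J: "finite J"
    and K: "disjoint_family_on K J"
    and P: "\<And>j. j \<in> J \<Longrightarrow> Measurable.pred (ecbp lam) (P j)"
    and det: "\<And>j. j \<in> J \<Longrightarrow> determined_by (K j) (P j)"
  shows "measure (ecbp lam) {X. \<forall>j\<in>J. P j X} = (\<Prod>j\<in>J. measure (ecbp lam) {X. P j X})"
proof (cases "J = {}")
  case True
  then show ?thesis using prob_space.prob_space[OF prob_space_ecbp, of lam] by simp
next
  case False
  interpret prob_space "ecbp lam" by (rule prob_space_ecbp)
  let ?Y = "\<lambda>j f. P j (\<lambda>p. if p \<in> K j then f p else 0)"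
  have Y: "Measurable.pred (Pi\<^sub>M (K j) (offspring_law lam)) (?Y j)" if "j \<in> J" for j
  proof (rule measurable_compose[OF _ P[OF that]])
    have "(\<lambda>f. \<lambda>p\<in>UNIV. if p \<in> K j then f p else 0)
        \<in> Pi\<^sub>M (K j) (offspring_law lam) \<rightarrow>\<^sub>M Pi\<^sub>M UNIV (offspring_law lam)"
    proof (rule measurable_restrict)
      fix p
      show "(\<lambda>f. if p \<in> K j then f p else 0)
          \<in> Pi\<^sub>M (K j) (offspring_law lam) \<rightarrow>\<^sub>M offspring_law lam p"
      proof (cases "p \<in> K j")
        case True
        then show ?thesis
          using measurable_component_singleton[of p "K j" "offspring_law lam"] by simp
      qed simp
    qed
    then show "(\<lambda>f p. if p \<in> K j then f p else 0)
        \<in> Pi\<^sub>M (K j) (offspring_law lam) \<rightarrow>\<^sub>M ecbp lam"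
      by (simp add: ecbp_eq restrict_UNIV)
  qed
  have Y_eq: "?Y j (restrict X (K j)) = P j X" if "j \<in> J" for j X
    using det[OF that] unfolding determined_by_def by (auto simp: restrict_def)
  have "indep_vars (offspring_law lam) (\<lambda>p X. X p) UNIV"
  proof (subst indep_vars_iff_distr_eq_PiM)
    show "distr (ecbp lam) (Pi\<^sub>M UNIV (offspring_law lam)) (\<lambda>X. \<lambda>p\<in>UNIV. X p)
        = Pi\<^sub>M UNIV (\<lambda>p. distr (ecbp lam) (offspring_law lam p) (\<lambda>X. X p))"
      by (simp only: distr_offspring restrict_UNIV flip: ecbp_eq) (rule distr_id)
  qed simp_all
  then have "indep_vars (\<lambda>j. Pi\<^sub>M (K j) (offspring_law lam)) (\<lambda>j X. restrict X (K j)) J"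
    using indep_vars_restrict[of "offspring_law lam" "\<lambda>p X. X p" UNIV J K] K by simp
  then have "indep_vars (\<lambda>_. count_space UNIV) (\<lambda>j X. ?Y j (restrict X (K j))) J"
    using Y by (rule indep_vars_compose2) auto
  from indep_varsD[OF this False J subset_refl, of "\<lambda>_. {True}"]
  have "prob (\<Inter>j\<in>J. {X. ?Y j (restrict X (K j))}) = (\<Prod>j\<in>J. prob {X. ?Y j (restrict X (K j))})"
    by (simp add: vimage_def)
  moreover have "(\<Inter>j\<in>J. {X. ?Y j (restrict X (K j))}) = {X. \<forall>j\<in>J. P j X}"
    using Y_eq by auto
  moreover have "(\<Prod>j\<in>J. prob {X. ?Y j (restrict X (K j))}) = (\<Prod>j\<in>J. prob {X. P j X})"
    using Y_eq by (intro prod.cong) auto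
  ultimately show ?thesis by simp
qed

lemma prob_conj_disjoint:
  assumes "K \<inter> L = {}"
    and "Measurable.pred (ecbp lam) P" "Measurable.pred (ecbp lam) Q"
    and "determined_by K P" "determined_by L Q"
  shows "measure (ecbp lam) {X. P X \<and> Q X}
      = measure (ecbp lam) {X. P X} * measure (ecbp lam) {X. Q X}"
proof -
  let ?K = "\<lambda>j::nat. if j = 0 then K else L" and ?P = "\<lambda>j::nat. if j = 0 then P else Q"
  have "measure (ecbp lam) {X. \<forall>j\<in>{0, 1}. ?P j X} = (\<Prod>j\<in>{0, 1}. measure (ecbp lam) {X. ?P j X})"
    by (rule prob_Ball_disjoint[where K = ?K])
      (use assms in \<open>auto simp: disjoint_family_on_def\<close>)
  then show ?thesis by simp
qed

section \<open>Avoiding paths in a fixed tree\<close>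

text \<open>
  Following the edges down from the root and dropping all children along edges of color \<open>i\<close>
  leaves a Galton--Watson tree; this says that its generation \<open>n\<close> is not empty.
\<close>

definition avoiding_generation :: "'k config \<Rightarrow> 'k \<Rightarrow> nat \<Rightarrow> bool" where
  "avoiding_generation X i n \<longleftrightarrow> (\<exists>w. length w = n \<and> in_tree X w \<and> i \<notin> fst ` set w)"

definition survives :: "'k config \<Rightarrow> 'k \<Rightarrow> bool" where
  "survives X i \<longleftrightarrow> (\<forall>n. avoiding_generation X i n)"

lemma in_tree_Cons: "in_tree X (a # v) \<longleftrightarrow> in_tree X v \<and> snd a < X (v, fst a)"
  by (cases a) simp

lemma in_tree_append: "in_tree X (w @ v) \<longleftrightarrow> in_tree X v \<and> in_tree (subtree v X) w"
  by (induction w) (auto simp: in_tree_Cons subtree_def)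

lemma subtree_subtree: "subtree u (subtree v X) = subtree (u @ v) X"
  by (auto simp: subtree_def fun_eq_iff)

lemma subtree_Nil [simp]: "subtree [] X = X"
  by (auto simp: subtree_def fun_eq_iff)

lemma avoiding_generation_0 [simp]: "avoiding_generation X i 0"
  by (auto simp: avoiding_generation_def)

lemma avoiding_generation_antimono:
  assumes "avoiding_generation X i n" "m \<le> n"
  shows "avoiding_generation X i m"
proof -
  from assms obtain w where w: "length w = n" "in_tree X w" "i \<notin> fst ` set w"
    by (auto simp: avoiding_generation_def)
  have "in_tree X (drop (n - m) w)"
    using w(2) in_tree_append[of X "take (n - m) w" "drop (n - m) w"] by simp
  moreover have "i \<notin> fst ` set (drop (n - m) w)"
    using w(3) set_drop_subset[of "n - m" w] by auto
  ultimately show ?thesis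
    using w(1) assms(2) by (auto simp: avoiding_generation_def intro!: exI[of _ "drop (n - m) w"])
qed

lemma avoiding_generation_Suc:
  "avoiding_generation X i (Suc n) \<longleftrightarrow>
     (\<exists>c m. c \<noteq> i \<and> m < X ([], c) \<and> avoiding_generation (subtree [(c, m)] X) i n)"
proof
  assume "avoiding_generation X i (Suc n)"
  then obtain w where w: "length w = Suc n" "in_tree X w" "i \<notin> fst ` set w"
    by (auto simp: avoiding_generation_def)
  then obtain u c m where u: "w = u @ [(c, m)]"
    by (metis length_0_conv nat.distinct(1) rev_exhaust surj_pair)
  with w show "\<exists>c m. c \<noteq> i \<and> m < X ([], c) \<and> avoiding_generation (subtree [(c, m)] X) i n"
    by (intro exI[of _ c] exI[of _ m]) (auto simp: avoiding_generation_def in_tree_append)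
next
  assume "\<exists>c m. c \<noteq> i \<and> m < X ([], c) \<and> avoiding_generation (subtree [(c, m)] X) i n"
  then obtain c m u where "c \<noteq> i" "m < X ([], c)" "length u = n"
    "in_tree (subtree [(c, m)] X) u" "i \<notin> fst ` set u"
    by (auto simp: avoiding_generation_def)
  then show "avoiding_generation X i (Suc n)"
    unfolding avoiding_generation_def
    by (intro exI[of _ "u @ [(c, m)]"]) (auto simp: in_tree_append)
qed

text \<open>
  Koenig's lemma, one step: the root has finitely many children, so if each of their subtrees died
  out there would be a generation by which all of them had died out.
\<close>

lemma survives_child:
  fixes X :: "('k::finite) config"
  assumes "survives X i"
  obtains c m where "c \<noteq> i" "m < X ([], c)" "survives (subtree [(c, m)] X) i"
proof (rule ccontr)
  assume "\<not> thesis"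
  then have "\<forall>c m. \<exists>n. c \<noteq> i \<and> m < X ([], c) \<longrightarrow> \<not> avoiding_generation (subtree [(c, m)] X) i n"
    using that by (auto simp: survives_def)
  then obtain h where h: "\<And>c m. c \<noteq> i \<Longrightarrow> m < X ([], c) \<Longrightarrow>
      \<not> avoiding_generation (subtree [(c, m)] X) i (h c m)"
    by metis
  define N where "N = Max ((\<lambda>(c, m). h c m) ` (SIGMA c:UNIV. {..<X ([], c)}))"
  have le: "h c m \<le> N" if "m < X ([], c)" for c m
    unfolding N_def using that by (intro Max_ge) (auto intro!: finite_imageI)
  have "avoiding_generation X i (Suc N)"
    using assms by (simp add: survives_def)
  then obtain c m where "c \<noteq> i" "m < X ([], c)" "avoiding_generation (subtree [(c, m)] X) i N"
    by (auto simp: avoiding_generation_Suc)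
  then show False using h[of c m] avoiding_generation_antimono[OF _ le, of _ i m c] by blast
qed

lemma survives_of_child:
  assumes "c \<noteq> i" "m < X ([], c)" "survives (subtree [(c, m)] X) i"
  shows "survives X i"
  unfolding survives_def
proof
  fix n
  show "avoiding_generation X i n"
    using assms by (cases n) (auto simp: survives_def avoiding_generation_Suc)
qed

text \<open>
  An injective path that stays among the descendants of its starting point \<open>v\<close> can never step to a
  parent: its first step would leave the subtree, and a later one would follow a step from a
  parent to its child, so it would return to that parent. Hence the \<open>n\<close>-th vertex of the path lies
  \<open>n\<close> generations below \<open>v\<close>. Conversely, a surviving vertex has a surviving child, and iterating
  the choice of such a child gives an infinite path. The right-hand side involves only countably
  many conditions on single vertices, which is what makes the event measurable.
\<close>

lemma avoiding_infinity_iff: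
  fixes X :: "('k::finite) config"
  shows "avoiding_infinity X i v \<longleftrightarrow> in_tree X v \<and> survives (subtree v X) i"
proof
  assume "avoiding_infinity X i v"
  then obtain p where p0: "p 0 = v" and inj: "inj p" and suf: "\<And>n. suffix v (p n)"
    and edge: "\<And>n. avoiding_edge X i (p n) (p (Suc n))"
    unfolding avoiding_infinity_def by blast
  have tree: "in_tree X (p n)" for n
    using edge[of n] unfolding avoiding_edge_def tree_edge_def by blast
  have step: "\<exists>c m. c \<noteq> i \<and> p (Suc n) = (c, m) # p n" for n
  proof (induction n)
    case 0
    have "\<not> (\<exists>a. p 0 = a # p (Suc 0))"
    proof
      assume "\<exists>a. p 0 = a # p (Suc 0)"
      then have "length (p (Suc 0)) < length v" using p0 by auto
      moreover have "length v \<le> length (p (Suc 0))" using suf by (rule suffix_length_le)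
      ultimately show False by simp
    qed
    then show ?case using edge[of 0] unfolding avoiding_edge_def tree_edge_def by blast
  next
    case (Suc n)
    have "p (Suc (Suc n)) \<noteq> p n"
      using inj by (auto dest: injD)
    then have "\<not> (\<exists>a. p (Suc n) = a # p (Suc (Suc n)))"
      using Suc by auto
    then show ?case using edge[of "Suc n"] unfolding avoiding_edge_def tree_edge_def by blast
  qed
  have "\<exists>w. p n = w @ v \<and> length w = n \<and> i \<notin> fst ` set w" for n
  proof (induction n)
    case (Suc n)
    then obtain w where "p n = w @ v" "length w = n" "i \<notin> fst ` set w" by blast
    moreover obtain c m where "c \<noteq> i" "p (Suc n) = (c, m) # p n" using step by blast
    ultimately show ?case by (intro exI[of _ "(c, m) # w"]) auto
  qed (simp add: p0)
  then have "avoiding_generation (subtree v X) i n" for n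
    using tree[of n] unfolding avoiding_generation_def by (metis in_tree_append)
  then show "in_tree X v \<and> survives (subtree v X) i"
    using tree[of 0] p0 by (simp add: survives_def)
next
  assume v: "in_tree X v \<and> survives (subtree v X) i"
  define good where "good u \<longleftrightarrow> in_tree X u \<and> survives (subtree u X) i" for u
  have "\<exists>u'. good u' \<and> (\<exists>c m. c \<noteq> i \<and> u' = (c, m) # u)" if "good u" for u
  proof -
    obtain c m where "c \<noteq> i" "m < subtree u X ([], c)" "survives (subtree [(c, m)] (subtree u X)) i"
      using \<open>good u\<close> survives_child[of "subtree u X" i] unfolding good_def by blast
    then show ?thesis using \<open>good u\<close>
      by (intro exI[of _ "(c, m) # u"]) (auto simp: good_def subtree_subtree, simp add: subtree_def)
  qed
  then obtain g where g: "\<And>u. good u \<Longrightarrow> good (g u) \<and> (\<exists>c m. c \<noteq> i \<and> g u = (c, m) # u)"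
    by metis
  define p where "p n = (g ^^ n) v" for n
  have p0: "p 0 = v" by (simp add: p_def)
  have good: "good (p n)" for n
    by (induction n) (use v g in \<open>auto simp: p_def good_def[of v]\<close>)
  have step: "\<exists>c m. c \<noteq> i \<and> p (Suc n) = (c, m) # p n" for n
    using g[OF good[of n]] by (simp add: p_def)
  have len: "length (p n) = length v + n" for n
  proof (induction n)
    case (Suc n)
    then show ?case using step[of n] by auto
  qed (simp add: p0)
  have "inj p"
  proof (rule injI)
    fix a b assume "p a = p b"
    then have "length v + a = length v + b" by (metis len)
    then show "a = b" by simp
  qed
  moreover have "suffix v (p n)" for n
  proof (induction n)
    case (Suc n)
    then show ?case using step[of n] by (auto simp: suffix_ConsI)
  qed (simp add: p0)
  moreover have "avoiding_edge X i (p n) (p (Suc n))" for n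
    using step[of n] good[of n] good[of "Suc n"]
    unfolding avoiding_edge_def tree_edge_def good_def by blast
  ultimately show "avoiding_infinity X i v"
    using p0 unfolding avoiding_infinity_def by blast
qed

text \<open>
  Along a path of edges that avoid color \<open>i\<close>, the words never acquire the letter \<open>i\<close>. Conversely
  the suffixes of \<open>v\<close>, from the shortest to the longest, form a path from the root to \<open>v\<close>; the bound
  on the lengths carried through the induction keeps this path free of repetitions.
\<close>

lemma avoiding_connected_root_iff:
  "avoiding_connected X i [] v \<longleftrightarrow> in_tree X v \<and> i \<notin> fst ` set v"
proof
  assume *: "avoiding_connected X i [] v"
  then obtain p where p: "p \<noteq> []" "hd p = []" "last p = v" "successively (avoiding_edge X i) p"
    by (auto simp: avoiding_connected_def)
  have edge: "i \<notin> fst ` set w" if "avoiding_edge X i u w" "i \<notin> fst ` set u" for u w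
    using that by (auto simp: avoiding_edge_def tree_edge_def)
  have "i \<notin> fst ` set (hd p) \<Longrightarrow> i \<notin> fst ` set (last p)"
    using p(1,4)
  proof (induction p rule: induct_list012)
    case (3 x y zs)
    then show ?case using edge[of x y] by simp
  qed simp_all
  moreover have "in_tree X v"
    using * last_in_set unfolding avoiding_connected_def by fast
  ultimately show "in_tree X v \<and> i \<notin> fst ` set v" using p by simp
next
  assume v: "in_tree X v \<and> i \<notin> fst ` set v"
  have "\<exists>p. p \<noteq> [] \<and> hd p = [] \<and> last p = v \<and> distinct p \<and> set p \<subseteq> Collect (in_tree X) \<and>
      successively (avoiding_edge X i) p \<and> (\<forall>u\<in>set p. length u \<le> length v)"
    using v
  proof (induction v)
    case Nil
    then show ?case by (intro exI[of _ "[[]]"]) simp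
  next
    case (Cons a v)
    then have "in_tree X v \<and> i \<notin> fst ` set v" by (simp add: in_tree_Cons)
    then obtain p where p: "p \<noteq> []" "hd p = []" "last p = v" "distinct p"
      "set p \<subseteq> Collect (in_tree X)" "successively (avoiding_edge X i) p"
      "\<forall>u\<in>set p. length u \<le> length v"
      using Cons.IH by blast
    have "avoiding_edge X i v (a # v)"
      unfolding avoiding_edge_def tree_edge_def using Cons.prems
      by (intro exI[of _ "fst a"] conjI exI[of _ "snd a"] disjI1) (auto simp: in_tree_Cons)
    moreover have "a # v \<notin> set p" using p(7) by fastforce
    ultimately show ?case
      using p Cons.prems
      by (intro exI[of _ "p @ [a # v]"]) (auto simp: successively_append_iff intro: le_SucI)
  qed
  then show "avoiding_connected X i [] v"
    unfolding avoiding_connected_def by blast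
qed

lemma finite_tree_below:
  fixes X :: "('k::finite) config"
  shows "finite {v. in_tree X v \<and> length v \<le> n}"
proof (induction n)
  case (Suc n)
  let ?T = "{v. in_tree X v \<and> length v \<le> n}"
  have "{v. in_tree X v \<and> length v \<le> Suc n}
      \<subseteq> insert [] ((\<lambda>(v, c, m). (c, m) # v) ` (SIGMA v:?T. SIGMA c:UNIV. {..<X (v, c)}))"
  proof
    fix v assume v: "v \<in> {v. in_tree X v \<and> length v \<le> Suc n}"
    show "v \<in> insert [] ((\<lambda>(v, c, m). (c, m) # v) ` (SIGMA v:?T. SIGMA c:UNIV. {..<X (v, c)}))"
    proof (cases v)
      case (Cons a u)
      with v show ?thesis
        by (cases a) (auto intro!: image_eqI[of _ _ "(u, fst a, snd a)"])
    qed simp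
  qed
  moreover have "finite (SIGMA v:?T. SIGMA c:UNIV. {..<X (v, c)})"
    using Suc by (intro finite_SigmaI) auto
  ultimately show ?case by (meson finite_imageI finite_insert finite_subset)
qed simp

text \<open>
  If color \<open>i\<close> cannot be avoided forever from the root, every friend is joined to the root by a path
  without color \<open>i\<close>, so all friends live in the finitely many generations that such paths reach.
\<close>

lemma finite_friends_if_not_survives:
  fixes X :: "('k::finite) config"
  assumes "\<not> survives X i"
  shows "finite (friends_of_root X)"
proof -
  from assms obtain n where n: "\<not> avoiding_generation X i n"
    by (auto simp: survives_def)
  have "friends_of_root X \<subseteq> {v. in_tree X v \<and> length v \<le> n}"
  proof
    fix v assume v: "v \<in> friends_of_root X"
    then have "in_tree X v" "avoiding_friend X i v"
      by (auto simp: friends_of_root_def)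
    then have "i \<notin> fst ` set v"
      using assms
      unfolding avoiding_friend_def avoiding_infinity_iff avoiding_connected_root_iff subtree_Nil by blast
    with \<open>in_tree X v\<close> have "avoiding_generation X i (length v)"
      unfolding avoiding_generation_def by blast
    then have "\<not> n \<le> length v"
      using n avoiding_generation_antimono[of X i "length v" n] by auto
    then show "v \<in> {v. in_tree X v \<and> length v \<le> n}"
      using \<open>in_tree X v\<close> by simp
  qed
  then show ?thesis by (rule finite_subset) (rule finite_tree_below)
qed

lemma friend_if_all_survive:
  fixes X :: "('k::finite) config"
  assumes "\<forall>i. survives X i" "in_tree X v" "\<forall>i. survives (subtree v X) i"
  shows "v \<in> friends_of_root X"
  using assms unfolding friends_of_root_def avoiding_friend_def avoiding_infinity_iff by simp

section \<open>Measurability\<close>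

lemma pred_in_tree [measurable]: "Measurable.pred (ecbp lam) (\<lambda>X. in_tree X v)"
proof (induction v)
  case (Cons a v)
  have "Measurable.pred (ecbp lam) (\<lambda>X. snd a < X (v, fst a))"
    by (rule measurable_compose[OF measurable_offspring]) simp
  with Cons show ?case unfolding in_tree_Cons by (intro pred_intros_logic(3))
qed simp

lemma pred_avoiding_generation [measurable]:
  fixes lam :: "real ^ 'k::finite"
  shows "Measurable.pred (ecbp lam) (\<lambda>X. avoiding_generation X i n)"
proof -
  have "Measurable.pred (ecbp lam)
      (\<lambda>X. \<exists>w\<in>{w. length w = n \<and> i \<notin> fst ` set w}. in_tree X w)"
    by (intro pred_intros_countable_bounded(4) pred_in_tree)
  moreover have "(\<exists>w\<in>{w. length w = n \<and> i \<notin> fst ` set w}. in_tree X w)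
      = avoiding_generation X i n" for X :: "'k config"
    unfolding avoiding_generation_def by blast
  ultimately show ?thesis by (simp only:)
qed

lemma pred_survives [measurable]:
  fixes lam :: "real ^ 'k::finite"
  shows "Measurable.pred (ecbp lam) (\<lambda>X. survives X i)"
  unfolding survives_def by (intro pred_intros_countable(1) pred_avoiding_generation)

lemma pred_friend [measurable]:
  fixes lam :: "real ^ 'k::finite"
  shows "Measurable.pred (ecbp lam) (\<lambda>X. v \<in> friends_of_root X)"
proof -
  have surv: "Measurable.pred (ecbp lam) (\<lambda>X. survives (subtree u X) i)" for u :: "'k vertex" and i
    by (rule measurable_compose[OF measurable_subtree pred_survives])
  have "Measurable.pred (ecbp lam) (\<lambda>X. in_tree X v \<and>
      (\<forall>i. (in_tree X v \<and> i \<notin> fst ` set v) \<or>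
           (in_tree X [] \<and> survives (subtree [] X) i) \<and> in_tree X v \<and> survives (subtree v X) i))"
    by (intro pred_intros_countable(1) pred_intros_logic(3,5) pred_in_tree surv measurable_const) simp_all
  then show ?thesis
    unfolding friends_of_root_def avoiding_friend_def avoiding_infinity_iff
      avoiding_connected_root_iff mem_Collect_eq .
qed

text \<open>
  Each vertex has finitely many children, so infinitely many friends must occupy arbitrarily late
  generations.
\<close>

lemma infinite_friends_iff:
  fixes X :: "('k::finite) config"
  shows "infinite (friends_of_root X) \<longleftrightarrow> (\<forall>n. \<exists>v. n < length v \<and> v \<in> friends_of_root X)"
proof
  assume inf: "infinite (friends_of_root X)"
  show "\<forall>n. \<exists>v. n < length v \<and> v \<in> friends_of_root X"
  proof (rule ccontr)
    assume "\<not> ?thesis"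
    then obtain n where "\<forall>v\<in>friends_of_root X. length v \<le> n"
      by (meson not_less)
    then have "friends_of_root X \<subseteq> {v. in_tree X v \<and> length v \<le> n}"
      by (auto simp: friends_of_root_def)
    then have "finite (friends_of_root X)" by (rule finite_subset) (rule finite_tree_below)
    with inf show False by simp
  qed
next
  assume unb: "\<forall>n. \<exists>v. n < length v \<and> v \<in> friends_of_root X"
  show "infinite (friends_of_root X)"
  proof
    assume "finite (friends_of_root X)"
    then have "\<forall>v\<in>friends_of_root X. length v \<le> Max (length ` friends_of_root X)" by simp
    with unb show False by (meson not_le)
  qed
qed

lemma pred_infinite_friends [measurable]:
  fixes lam :: "real ^ 'k::finite"
  shows "Measurable.pred (ecbp lam) (\<lambda>X. infinite (friends_of_root X))"
proof -
  have "Measurable.pred (ecbp lam)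
      (\<lambda>X. \<forall>n. \<exists>v\<in>{v. n < length v}. v \<in> friends_of_root X)"
    by (intro pred_intros_countable(1) pred_intros_countable_bounded(4) pred_friend)
  then show ?thesis by (simp only: infinite_friends_iff Bex_def mem_Collect_eq)
qed

section \<open>Survival of the branching process without one color\<close>

definition coords_below :: "'k vertex \<Rightarrow> ('k vertex \<times> 'k) set" where
  "coords_below v = {(u, c). suffix v u}"

lemma determined_by_subtree: "determined_by (coords_below v) (\<lambda>X. P (subtree v X))"
proof -
  have "subtree v X = subtree v Y" if "\<forall>p\<in>coords_below v. X p = Y p" for X Y :: "'a config"
    using that by (auto simp: subtree_def coords_below_def fun_eq_iff suffix_def)
  then show ?thesis unfolding determined_by_def by metis
qed

lemma determined_by_mono: "determined_by K P \<Longrightarrow> K \<subseteq> L \<Longrightarrow> determined_by L P"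
  unfolding determined_by_def by blast

lemma determined_by_Ball:
  "(\<And>j. j \<in> J \<Longrightarrow> determined_by K (P j)) \<Longrightarrow> determined_by K (\<lambda>X. \<forall>j\<in>J. P j X)"
  unfolding determined_by_def by blast

lemma pred_subtree:
  assumes "Measurable.pred (ecbp lam) P"
  shows "Measurable.pred (ecbp lam) (\<lambda>X. P (subtree v X))"
  by (rule measurable_compose[OF measurable_subtree assms])

lemma pred_offspring: "Measurable.pred (ecbp lam) (\<lambda>X. Q (X p))"
  by (rule measurable_compose[OF measurable_offspring]) simp

lemma pred_children:
  assumes "Measurable.pred (ecbp lam) P"
  shows "Measurable.pred (ecbp lam) (\<lambda>X. \<forall>m<X ([], c). P (subtree [(c, m)] X))"
  by (intro pred_intros_countable(1) pred_intros_logic(4) pred_subtree[OF assms] pred_offspring)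

lemma coords_below_children_disjoint:
  "a \<noteq> b \<Longrightarrow> coords_below [a] \<inter> coords_below [b] = {}"
  by (auto simp: coords_below_def suffix_def)

lemma root_notin_coords_below: "([], c) \<notin> coords_below [a]"
  by (auto simp: coords_below_def suffix_def)

text \<open>
  With \<open>q\<close> the probability of \<open>P\<close>, the left-hand side is the expectation of \<open>q\<close> raised to the
  number of children of color \<open>c\<close>, i.e. the generating function of the Poisson distribution at
  \<open>q\<close>. The proof splits according to that number, on which the subtrees of the children do not
  depend.
\<close>

lemma prob_all_children:
  assumes pos: "lam $ c > 0" and P: "Measurable.pred (ecbp lam) P"
  shows "measure (ecbp lam) {X. \<forall>m<X ([], c). P (subtree [(c, m)] X)}
      = exp (lam $ c * (measure (ecbp lam) {X. P X} - 1))"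
proof -
  interpret prob_space "ecbp lam" by (rule prob_space_ecbp)
  define q where "q = prob {X. P X}"
  let ?Q = "\<lambda>x X. \<forall>m\<in>{..<x}. P (subtree [(c, m)] X)"
  let ?A = "\<lambda>x. {X. X ([], c) = x \<and> ?Q x X}"
  let ?L = "\<Union>m. coords_below [(c, m)]"
  have pQ: "Measurable.pred (ecbp lam) (?Q x)" for x
    by (intro pred_intros_finite(3) pred_subtree P) simp
  have pA: "Measurable.pred (ecbp lam) (\<lambda>X. X ([], c) = x \<and> ?Q x X)" for x
    by (intro pred_intros_logic(3) pQ pred_offspring)
  have "prob (?A x) = lam $ c ^ x / fact x * exp (- (lam $ c)) * q ^ x" for x
  proof -
    have "prob (?A x) = prob {X. X ([], c) = x} * prob {X. ?Q x X}"
    proof (rule prob_conj_disjoint)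
      show "{([], c)} \<inter> ?L = {}" using root_notin_coords_below by fast
      show "determined_by {([], c)} (\<lambda>X. X ([], c) = x)" by (simp add: determined_by_def)
      show "determined_by ?L (?Q x)"
        by (intro determined_by_Ball determined_by_mono[OF determined_by_subtree]) blast
    qed (rule pred_offspring pQ)+
    also have "prob {X. ?Q x X} = (\<Prod>m\<in>{..<x}. prob {X. P (subtree [(c, m)] X)})"
    proof (rule prob_Ball_disjoint)
      show "disjoint_family_on (\<lambda>m. coords_below [(c, m)]) {..<x}"
        by (auto simp: disjoint_family_on_def coords_below_children_disjoint)
    qed (auto intro: pred_subtree P determined_by_subtree)
    also have "\<dots> = q ^ x"
      by (simp add: q_def prob_subtree[OF P])
    also have "prob {X. X ([], c) = x} = lam $ c ^ x / fact x * exp (- (lam $ c))"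
      using pos by (simp add: prob_offspring)
    finally show ?thesis .
  qed
  moreover have "(\<lambda>x. prob (?A x)) sums prob (\<Union>x. ?A x)"
  proof (rule finite_measure_UNION)
    show "range ?A \<subseteq> events" using pA by (auto simp: sets_ecbp_iff)
    show "disjoint_family ?A" by (auto simp: disjoint_family_on_def)
  qed
  moreover have "(\<Union>x. ?A x) = {X. \<forall>m<X ([], c). P (subtree [(c, m)] X)}"
    by auto
  ultimately have "(\<lambda>x. lam $ c ^ x / fact x * exp (- (lam $ c)) * q ^ x) sums
      prob {X. \<forall>m<X ([], c). P (subtree [(c, m)] X)}"
    by simp
  moreover have "(\<lambda>x. lam $ c ^ x / fact x * exp (- (lam $ c)) * q ^ x) sums
      (exp (- (lam $ c)) * exp (lam $ c * q))"
    using sums_mult[OF exp_converges[of "lam $ c * q"], of "exp (- (lam $ c))"]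
    by (simp add: power_mult_distrib field_simps)
  ultimately have "prob {X. \<forall>m<X ([], c). P (subtree [(c, m)] X)}
      = exp (- (lam $ c)) * exp (lam $ c * q)"
    by (rule sums_unique2)
  then show ?thesis
    by (simp add: q_def algebra_simps flip: exp_add)
qed

definition avoiding_mean :: "real ^ 'k::finite \<Rightarrow> 'k \<Rightarrow> real" where
  "avoiding_mean lam i = (\<Sum>c\<in>UNIV - {i}. lam $ c)"

definition extinction_prob :: "real ^ 'k::finite \<Rightarrow> 'k \<Rightarrow> nat \<Rightarrow> real" where
  "extinction_prob lam i n = measure (ecbp lam) {X. \<not> avoiding_generation X i n}"

lemma extinction_prob_0 [simp]: "extinction_prob lam i 0 = 0"
  by (simp add: extinction_prob_def)

text \<open>
  The process without color \<open>i\<close> is dead in generation \<open>n + 1\<close> iff for each other color it is dead in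
  generation \<open>n\<close> of the subtree of every child of that color. The colors are independent, and
  the product of their generating functions is that of a Poisson variable whose mean is the sum
  of the rates.
\<close>

lemma extinction_prob_Suc:
  fixes lam :: "real ^ 'k::finite"
  assumes pos: "\<And>c. lam $ c > 0"
  shows "extinction_prob lam i (Suc n) = exp (avoiding_mean lam i * (extinction_prob lam i n - 1))"
proof -
  let ?P = "\<lambda>X. \<not> avoiding_generation X i n"
  let ?K = "\<lambda>c. insert ([], c) (\<Union>m. coords_below [(c, m)])"
  let ?E = "\<lambda>c X. \<forall>m<X ([], c). ?P (subtree [(c, m)] X)"
  have P: "Measurable.pred (ecbp lam) ?P"
    by (intro pred_intros_logic(2) pred_avoiding_generation)
  have "{X. \<not> avoiding_generation X i (Suc n)} = {X :: 'k config. \<forall>c\<in>UNIV - {i}. ?E c X}"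
    unfolding avoiding_generation_Suc by blast
  then have "extinction_prob lam i (Suc n) = measure (ecbp lam) {X. \<forall>c\<in>UNIV - {i}. ?E c X}"
    by (simp add: extinction_prob_def)
  also have "\<dots> = (\<Prod>c\<in>UNIV - {i}. measure (ecbp lam) {X. ?E c X})"
  proof (rule prob_Ball_disjoint)
    have K_disjoint: "?K c \<inter> ?K d = {}" if "c \<noteq> d" for c d :: 'k
    proof -
      let ?S = "\<lambda>c. {p :: 'k vertex \<times> 'k. p = ([], c) \<or> (\<exists>w m. fst p = w @ [(c, m)])}"
      have "?K c \<inter> ?K d \<subseteq> ?S c \<inter> ?S d"
        by (intro Int_mono) (auto simp: coords_below_def suffix_def)
      also have "?S c \<inter> ?S d = {}"
        using \<open>c \<noteq> d\<close> by auto
      finally show ?thesis by simp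
    qed
    show "disjoint_family_on ?K (UNIV - {i})"
      unfolding disjoint_family_on_def by (intro ballI impI K_disjoint)
    show "determined_by (?K c) (?E c)" for c
    proof -
      have "determined_by (?K c) (\<lambda>X. ?P (subtree [(c, m)] X))" for m
        by (rule determined_by_mono[OF determined_by_subtree]) blast
      then show ?thesis unfolding determined_by_def by (metis insertI1)
    qed
  qed (auto intro: pred_children[OF P])
  also have "\<dots> = (\<Prod>c\<in>UNIV - {i}. exp (lam $ c * (extinction_prob lam i n - 1)))"
    by (simp add: prob_all_children[OF pos P] extinction_prob_def)
  also have "\<dots> = exp (avoiding_mean lam i * (extinction_prob lam i n - 1))"
    by (simp add: avoiding_mean_def sum_distrib_right exp_sum)
  finally show ?thesis .
qed

lemma prob_survives:
  fixes lam :: "real ^ 'k::finite"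
  shows "(\<lambda>n. 1 - extinction_prob lam i n) \<longlonglongrightarrow> measure (ecbp lam) {X. survives X i}"
proof -
  interpret prob_space "ecbp lam" by (rule prob_space_ecbp)
  let ?A = "\<lambda>n. {X. avoiding_generation X i n}"
  have A: "?A n \<in> events" for n
    unfolding sets_ecbp_iff by (rule pred_avoiding_generation)
  have "(\<lambda>n. prob (?A n)) \<longlonglongrightarrow> prob (\<Inter>n. ?A n)"
  proof (rule finite_Lim_measure_decseq)
    show "decseq ?A"
    proof (rule decseq_SucI)
      show "?A (Suc n) \<subseteq> ?A n" for n
        by (intro Collect_mono impI) (erule avoiding_generation_antimono, simp)
    qed
  qed (use A in auto)
  moreover have "prob (?A n) = 1 - extinction_prob lam i n" for n
  proof -
    have "space (ecbp lam) - ?A n = {X. \<not> avoiding_generation X i n}" by auto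
    then show ?thesis using prob_compl[OF A[of n]] by (simp only: extinction_prob_def)
  qed
  moreover have "(\<Inter>n. ?A n) = {X. survives X i}"
    by (auto simp: survives_def)
  ultimately show ?thesis by simp
qed

text \<open>
  For mean \<open>m > 1\<close> the extinction probabilities never exceed \<open>1 / m\<close>: the recursion
  \<open>q \<mapsto> exp (m * (q - 1))\<close> is increasing and maps \<open>1 / m\<close> to \<open>1 / exp (m - 1)\<close>, which is at most
  \<open>1 / m\<close> because \<open>m \<le> exp (m - 1)\<close>.
\<close>

lemma survives_pos_if_supercritical:
  fixes lam :: "real ^ 'k::finite"
  assumes pos: "\<And>c. lam $ c > 0" and super: "avoiding_mean lam i > 1"
  shows "measure (ecbp lam) {X. survives X i} > 0"
proof -
  define m where "m = avoiding_mean lam i"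
  have m: "m > 1" using super by (simp add: m_def)
  have bound: "extinction_prob lam i n \<le> 1 / m" for n
  proof (induction n)
    case 0
    then show ?case using m by simp
  next
    case (Suc n)
    have "extinction_prob lam i (Suc n) = exp (m * (extinction_prob lam i n - 1))"
      by (simp add: extinction_prob_Suc[OF pos] m_def)
    also have "\<dots> \<le> exp (m * (1 / m - 1))"
      using Suc m by (intro exp_le_cancel_iff[THEN iffD2] mult_left_mono) auto
    also have "\<dots> = 1 / exp (m - 1)"
      using m by (simp add: right_diff_distrib exp_diff)
    also have "\<dots> \<le> 1 / m"
      using m exp_ge_add_one_self[of "m - 1"] by (intro divide_left_mono) auto
    finally show ?case .
  qed
  have "1 - 1 / m \<le> measure (ecbp lam) {X. survives X i}"
    by (rule LIMSEQ_le_const[OF prob_survives]) (intro exI allI impI diff_left_mono bound)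
  moreover have "1 / m < 1" using m by simp
  ultimately show ?thesis by linarith
qed

text \<open>
  Passing to the limit in the recursion, the survival probability \<open>s\<close> satisfies
  \<open>1 - s = exp (- m * s)\<close>. For \<open>m \<le> 1\<close> this forces equality in the tangent inequality
  \<open>1 - s \<le> exp (- s)\<close>, which holds only at \<open>s = 0\<close>. This covers the critical case \<open>m = 1\<close> as well.
\<close>

lemma survives_null_if_not_supercritical:
  fixes lam :: "real ^ 'k::finite"
  assumes pos: "\<And>c. lam $ c > 0" and sub: "avoiding_mean lam i \<le> 1"
  shows "measure (ecbp lam) {X. survives X i} = 0"
proof -
  define m where "m = avoiding_mean lam i"
  define s where "s = measure (ecbp lam) {X. survives X i}"
  have lim: "(\<lambda>n. 1 - extinction_prob lam i n) \<longlonglongrightarrow> s"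
    unfolding s_def by (rule prob_survives)
  have "(\<lambda>n. 1 - extinction_prob lam i (Suc n)) \<longlonglongrightarrow> 1 - exp (- (m * s))"
  proof -
    have "(\<lambda>n. 1 - exp (- (m * (1 - extinction_prob lam i n)))) \<longlonglongrightarrow> 1 - exp (- (m * s))"
      by (intro tendsto_intros lim)
    then show ?thesis
      unfolding extinction_prob_Suc[OF pos] m_def[symmetric] by (simp add: algebra_simps)
  qed
  with LIMSEQ_Suc[OF lim] have fix_pt: "s = 1 - exp (- (m * s))"
    by (rule LIMSEQ_unique)
  have "s \<ge> 0" unfolding s_def by (rule measure_nonneg)
  have "1 - s \<le> exp (- s)"
    using exp_ge_add_one_self[of "- s"] by simp
  moreover have "exp (- s) \<le> exp (- (m * s))"
    using sub \<open>s \<ge> 0\<close> mult_right_mono[of m 1 s] by (simp add: m_def)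
  ultimately have "exp (- s) = 1 - s" using fix_pt by linarith
  then have "ln (exp (- s)) = exp (- s) - 1" by (subst ln_exp) simp
  then have "exp (- s) = 1" by (intro ln_eq_minus_one) simp_all
  then show "s = 0" by simp
qed

section \<open>Vertices from which every color can be avoided forever\<close>

lemma determined_by_in_tree:
  assumes "length v \<le> n"
  shows "determined_by {(u, c). length u < n} (\<lambda>X. in_tree X v)"
  using assms by (induction v) (auto simp: determined_by_def in_tree_Cons)

lemma prob_root_offspring_pos:
  fixes lam :: "real ^ 'k::finite"
  assumes pos: "\<And>c. lam $ c > 0"
  shows "measure (ecbp lam) {X. \<forall>c. X ([], c) = N} > 0"
proof -
  have "measure (ecbp lam) {X. \<forall>c\<in>UNIV. X ([], c) = N}
      = (\<Prod>c\<in>UNIV. measure (ecbp lam) {X. X ([], c) = N})"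
  proof (rule prob_Ball_disjoint)
    show "disjoint_family_on (\<lambda>c. {([], c)}) (UNIV :: 'k set)"
      by (simp add: disjoint_family_on_def)
  qed (auto intro: pred_offspring simp: determined_by_def)
  also have "\<dots> > 0"
    by (intro prod_pos) (simp add: prob_offspring pos)
  finally show ?thesis by simp
qed

text \<open>
  Survival without color \<open>i\<close> is inherited from a single child along an edge of another color. So
  it is enough that different children of the root take care of the different colors and that
  yet another child satisfies \<open>Q\<close>. These requirements concern disjoint subtrees, so they are
  independent of each other and of the offspring numbers of the root. The constant
  \<open>\<kappa>\<close> is the same for every \<open>Q\<close>, which later makes a bound uniform in the generation.
\<close>

lemma prob_all_survive_and_child:
  fixes lam :: "real ^ 'k::finite"
  assumes pos: "\<And>c. lam $ c > 0" and super: "fully_supercritical lam"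
  obtains \<kappa> where "\<kappa> > 0"
    "\<And>Q. Measurable.pred (ecbp lam) Q \<Longrightarrow>
      \<kappa> * measure (ecbp lam) {X. Q X}
        \<le> measure (ecbp lam)
             {X. (\<forall>i. survives X i) \<and> (\<exists>c m. m < X ([], c) \<and> Q (subtree [(c, m)] X))}"
proof -
  interpret prob_space "ecbp lam" by (rule prob_space_ecbp)
  have mean: "avoiding_mean lam i > 1" for i
    using super by (simp add: fully_supercritical_def avoiding_mean_def)
  \<comment> \<open>A single color is impossible here, as the sum of the other rates would be empty.\<close>
  have "\<exists>j. j \<noteq> i" for i :: 'k
  proof (rule ccontr)
    assume "\<nexists>j. j \<noteq> i"
    then have "UNIV - {i} = {}" by auto
    then have "avoiding_mean lam i = 0" by (simp only: avoiding_mean_def sum.empty)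
    then show False using mean[of i] by simp
  qed
  then obtain j where j: "\<And>i :: 'k. j i \<noteq> i" by metis
  \<comment> \<open>The child \<open>a (Some i)\<close> is in charge of avoiding color \<open>i\<close>; the child \<open>a None\<close>, the one with
  number \<open>0\<close>, is reserved for \<open>Q\<close>. Its color is arbitrary.\<close>
  define a :: "'k option \<Rightarrow> 'k \<times> nat" where
    "a l = (case l of None \<Rightarrow> (undefined, 0) | Some i \<Rightarrow> (j i, Suc (to_nat i)))" for l
  have inj_a: "a l \<noteq> a l'" if "l \<noteq> l'" for l l'
    using that by (cases l; cases l') (auto simp: a_def)
  \<comment> \<open>Large enough that all the children \<open>a l\<close> exist when every color has exactly \<open>N\<close> children.\<close>
  define N where "N = Suc (Suc (Max (range (to_nat :: 'k \<Rightarrow> nat))))"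
  have "to_nat i \<le> Max (range (to_nat :: 'k \<Rightarrow> nat))" for i :: 'k
    by (intro Max_ge) auto
  then have a_less: "snd (a l) < N" for l
    by (auto simp: a_def N_def less_Suc_eq_le split: option.splits)
  define root where "root = prob {X. \<forall>c. X ([], c) = N}"
  let ?s = "\<Prod>i\<in>UNIV. prob {X. survives X i}"
  have pred_root: "Measurable.pred (ecbp lam) (\<lambda>X. \<forall>c. X ([], c) = N)"
    by (intro pred_intros_countable(1) pred_offspring)
  have surv_pred: "Measurable.pred (ecbp lam) (\<lambda>X. \<forall>i. survives X i)"
    by (intro pred_intros_countable(1) pred_survives)
  show thesis
  proof (rule that)
    show "root * ?s > 0"
      unfolding root_def
      by (intro mult_pos_pos prod_pos prob_root_offspring_pos pos survives_pos_if_supercritical mean)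
  next
    fix Q assume Q: "Measurable.pred (ecbp lam) Q"
    define R where "R l = (case l of None \<Rightarrow> Q | Some i \<Rightarrow> (\<lambda>X. survives X i))" for l
    have R: "Measurable.pred (ecbp lam) (R l)" for l
      by (cases l) (simp_all add: R_def Q pred_survives)
    let ?K = "\<lambda>l. coords_below [a l]"
    let ?S = "\<lambda>X. \<forall>l\<in>UNIV. R l (subtree [a l] X)"
    have pred_S: "Measurable.pred (ecbp lam) ?S"
      by (intro pred_intros_finite(3) pred_subtree R) simp
    have "prob {X. (\<forall>c. X ([], c) = N) \<and> ?S X} = root * prob {X. ?S X}"
      unfolding root_def
    proof (rule prob_conj_disjoint[OF _ pred_root pred_S])
      show "range (Pair []) \<inter> (\<Union>l. ?K l) = {}"
        using root_notin_coords_below by fast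
      show "determined_by (range (Pair [])) (\<lambda>X. \<forall>c. X ([], c) = N)"
        by (simp add: determined_by_def)
      show "determined_by (\<Union>l. ?K l) ?S"
        by (intro determined_by_Ball determined_by_mono[OF determined_by_subtree]) blast
    qed
    also have "prob {X. ?S X} = (\<Prod>l\<in>UNIV. prob {X. R l (subtree [a l] X)})"
    proof (rule prob_Ball_disjoint)
      show "disjoint_family_on ?K UNIV"
        unfolding disjoint_family_on_def using inj_a coords_below_children_disjoint by blast
    qed (auto intro: pred_subtree R determined_by_subtree)
    also have "\<dots> = prob {X. Q X} * ?s"
      by (simp add: prob_subtree[OF R] UNIV_option_conv prod.reindex) (simp add: R_def)
    also have "root * (prob {X. Q X} * ?s) = root * ?s * prob {X. Q X}" by simp
    finally have "root * ?s * prob {X. Q X} = prob {X. (\<forall>c. X ([], c) = N) \<and> ?S X}" by simp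
    also have "\<dots> \<le> prob {X. (\<forall>i. survives X i) \<and>
        (\<exists>c m. m < X ([], c) \<and> Q (subtree [(c, m)] X))}"
    proof (rule finite_measure_mono)
      show "{X. (\<forall>c. X ([], c) = N) \<and> ?S X} \<subseteq> {X. (\<forall>i. survives X i) \<and>
          (\<exists>c m. m < X ([], c) \<and> Q (subtree [(c, m)] X))}"
      proof safe
        fix X i
        assume root: "\<forall>c. X ([], c) = N" and S: "?S X"
        have "R (Some i) (subtree [a (Some i)] X)" using S by blast
        then have "survives (subtree [(j i, Suc (to_nat i))] X) i"
          by (simp add: R_def a_def)
        moreover have "Suc (to_nat i) < X ([], j i)"
          using a_less[of "Some i"] root by (simp add: a_def)
        ultimately show "survives X i" using survives_of_child[OF j] by blast
      next
        fix X
        assume root: "\<forall>c. X ([], c) = N" and S: "?S X"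
        have "R None (subtree [a None] X)" using S by blast
        then have "Q (subtree [a None] X)" by (simp add: R_def)
        then show "\<exists>c m. m < X ([], c) \<and> Q (subtree [(c, m)] X)"
          using a_less[of None] root by (metis prod.collapse)
      qed
      show "{X. (\<forall>i. survives X i) \<and> (\<exists>c m. m < X ([], c) \<and> Q (subtree [(c, m)] X))} \<in> events"
        unfolding sets_ecbp_iff
        by (intro pred_intros_logic(3) pred_intros_countable surv_pred pred_offspring pred_subtree Q)
    qed
    finally show "root * ?s * prob {X. Q X} \<le> \<dots>" .
  qed
qed

text \<open>
  Generation \<open>n\<close> is explored without looking at offspring numbers in it or below it. The vertex of
  generation \<open>n\<close> that comes first in a fixed enumeration is therefore known independently of its
  subtree, which satisfies \<open>Q\<close> with the unconditional probability.
\<close>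

lemma prob_vertex_in_generation:
  fixes lam :: "real ^ 'k::finite"
  assumes Q: "Measurable.pred (ecbp lam) Q"
  shows "measure (ecbp lam) {X. \<exists>v. length v = n \<and> in_tree X v} * measure (ecbp lam) {X. Q X}
      \<le> measure (ecbp lam) {X. \<exists>v. length v = n \<and> in_tree X v \<and> Q (subtree v X)}"
proof -
  interpret prob_space "ecbp lam" by (rule prob_space_ecbp)
  \<comment> \<open>\<open>g e\<close> says that the vertex with number \<open>e\<close> belongs to generation \<open>n\<close> of the tree, and \<open>F e\<close>
  that it is the first one to do so.\<close>
  define g where "g e X \<longleftrightarrow> length (from_nat e :: 'k vertex) = n \<and> in_tree X (from_nat e)"
    for e and X :: "'k config"
  define F where "F e X \<longleftrightarrow> g e X \<and> (\<forall>e'\<in>{..<e}. \<not> g e' X)" for e X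
  let ?Q = "\<lambda>e X. Q (subtree (from_nat e) X)"
  let ?below = "{(u, c). length u < n} :: ('k vertex \<times> 'k) set"
  have pred_g: "Measurable.pred (ecbp lam) (g e)" for e
    unfolding g_def by (intro pred_intros_logic(3) pred_in_tree measurable_const) simp
  have pred_F: "Measurable.pred (ecbp lam) (F e)" for e
    unfolding F_def by (intro pred_intros_logic(2,3) pred_intros_finite(3) pred_g) simp
  have pred_FQ: "Measurable.pred (ecbp lam) (\<lambda>X. F e X \<and> ?Q e X)" for e
    by (intro pred_intros_logic(3) pred_F pred_subtree Q)
  have det_g: "determined_by ?below (g e)" for e
  proof (cases "length (from_nat e :: 'k vertex) = n")
    case True
    then show ?thesis using determined_by_in_tree[of "from_nat e :: 'k vertex" n] by (simp add: g_def[abs_def])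
  qed (simp add: g_def[abs_def] determined_by_def)
  have det_F: "determined_by ?below (F e)" for e
    using det_g unfolding F_def[abs_def] determined_by_def by blast
  have indep: "prob {X. F e X \<and> ?Q e X} = prob {X. F e X} * prob {X. Q X}" for e
  proof (cases "length (from_nat e :: 'k vertex) = n")
    case True
    then have "?below \<inter> coords_below (from_nat e) = {}"
      using suffix_length_le by (fastforce simp: coords_below_def)
    then have "prob {X. F e X \<and> ?Q e X} = prob {X. F e X} * prob {X. ?Q e X}"
      by (rule prob_conj_disjoint) (intro pred_F pred_subtree Q det_F determined_by_subtree)+
    then show ?thesis by (simp add: prob_subtree[OF Q])
  next
    case False
    then show ?thesis by (simp add: F_def g_def)
  qed
  have first: "(\<exists>v. length v = n \<and> in_tree X v) \<longleftrightarrow> (\<exists>e. F e X)" for X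
  proof -
    have "(\<exists>v. length v = n \<and> in_tree X v) \<longleftrightarrow> (\<exists>e. g e X)"
      unfolding g_def by (metis from_nat_to_nat)
    also have "\<dots> \<longleftrightarrow> (\<exists>e. F e X)"
      unfolding F_def by (subst exists_least_iff) auto
    finally show ?thesis .
  qed
  have disj: "F e X \<Longrightarrow> F e' X \<Longrightarrow> e = e'" for e e' X
    unfolding F_def by (metis lessThan_iff nat_neq_iff)
  have "(\<lambda>e. prob {X. F e X}) sums prob (\<Union>e. {X. F e X})"
    using pred_F disj
    by (intro finite_measure_UNION) (auto simp: sets_ecbp_iff disjoint_family_on_def)
  then have "(\<lambda>e. prob {X. F e X} * prob {X. Q X}) sums
      (prob (\<Union>e. {X. F e X}) * prob {X. Q X})"
    by (rule sums_mult2)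
  moreover have "(\<lambda>e. prob {X. F e X \<and> ?Q e X}) sums prob (\<Union>e. {X. F e X \<and> ?Q e X})"
    using pred_FQ disj
    by (intro finite_measure_UNION) (auto simp: sets_ecbp_iff disjoint_family_on_def)
  ultimately have "prob (\<Union>e. {X. F e X}) * prob {X. Q X} = prob (\<Union>e. {X. F e X \<and> ?Q e X})"
    unfolding indep by (rule sums_unique2)
  moreover have "(\<Union>e. {X. F e X}) = {X. \<exists>v. length v = n \<and> in_tree X v}"
    unfolding first by blast
  moreover have "prob (\<Union>e. {X. F e X \<and> ?Q e X})
      \<le> prob {X. \<exists>v\<in>{v. length v = n}. in_tree X v \<and> Q (subtree v X)}"
  proof (rule finite_measure_mono)
    show "(\<Union>e. {X. F e X \<and> ?Q e X}) \<subseteq> {X. \<exists>v\<in>{v. length v = n}. in_tree X v \<and> Q (subtree v X)}"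
      unfolding F_def g_def by blast
    show "{X. \<exists>v\<in>{v. length v = n}. in_tree X v \<and> Q (subtree v X)} \<in> events"
      unfolding sets_ecbp_iff
      by (intro pred_intros_countable_bounded(4) pred_intros_logic(3) pred_in_tree pred_subtree Q)
  qed
  ultimately show ?thesis by (simp only: Bex_def mem_Collect_eq)
qed

text \<open>
  Call a vertex immortal if each color can be avoided forever below it. If the root is immortal,
  every immortal vertex is a friend of it. Having an immortal root together with an immortal vertex
  in generation \<open>n\<close> has a probability bounded below by some \<open>c > 0\<close> that does not depend on \<open>n\<close>,
  so by continuity of the measure this happens for infinitely many \<open>n\<close> with probability at least
  \<open>c\<close>.
\<close>

lemma f_star_infinity_pos:
  fixes lam :: "real ^ 'k::finite"
  assumes pos: "\<And>c. lam $ c > 0" and super: "fully_supercritical lam"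
  shows "f_star_infinity lam > 0"
proof -
  interpret prob_space "ecbp lam" by (rule prob_space_ecbp)
  define immortal :: "'k config \<Rightarrow> bool" where "immortal X \<longleftrightarrow> (\<forall>i. survives X i)" for X
  define H where "H n X \<longleftrightarrow> (\<exists>v. length v = n \<and> in_tree X v \<and> immortal (subtree v X))"
    for n and X :: "'k config"
  obtain \<kappa> where \<kappa>: "\<kappa> > 0" and bound: "\<And>Q. Measurable.pred (ecbp lam) Q \<Longrightarrow>
      \<kappa> * prob {X. Q X} \<le> prob {X. immortal X \<and> (\<exists>c m. m < X ([], c) \<and> Q (subtree [(c, m)] X))}"
    using prob_all_survive_and_child[OF pos super] unfolding immortal_def by blast
  have pred_immortal: "Measurable.pred (ecbp lam) immortal"
    unfolding immortal_def by (intro pred_intros_countable(1) pred_survives)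
  have pred_H: "Measurable.pred (ecbp lam) (H n)" for n
  proof -
    have "Measurable.pred (ecbp lam)
        (\<lambda>X. \<exists>v\<in>{v. length v = n}. in_tree X v \<and> immortal (subtree v X))"
      by (intro pred_intros_countable_bounded(4) pred_intros_logic(3) pred_in_tree
          pred_subtree pred_immortal)
    then show ?thesis unfolding H_def by (simp only: Bex_def mem_Collect_eq)
  qed
  have imm_pos: "prob {X. immortal X} > 0"
  proof -
    have "\<kappa> \<le> prob {X. immortal X \<and> (\<exists>c m. m < X ([], c) \<and> True)}"
      using bound[of "\<lambda>_. True"] prob_space by simp
    also have "\<dots> \<le> prob {X. immortal X}"
      by (rule finite_measure_mono) (auto simp: sets_ecbp_iff pred_immortal)
    finally show ?thesis using \<kappa> by simp
  qed
  define \<theta> where "\<theta> = prob {X. survives X (undefined :: 'k)}"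
  have \<theta>: "\<theta> > 0"
    unfolding \<theta>_def using super
    by (intro survives_pos_if_supercritical pos) (simp add: fully_supercritical_def avoiding_mean_def)
  have H_ge: "\<theta> * prob {X. immortal X} \<le> prob {X. H n X}" for n
  proof -
    have "\<theta> \<le> prob {X. \<exists>v\<in>{v. length v = n}. in_tree X v}"
      unfolding \<theta>_def
    proof (rule finite_measure_mono)
      show "{X. survives X (undefined :: 'k)} \<subseteq> {X. \<exists>v\<in>{v. length v = n}. in_tree X v}"
        unfolding survives_def avoiding_generation_def by blast
      show "{X. \<exists>v\<in>{v. length v = n}. in_tree X v} \<in> events"
        unfolding sets_ecbp_iff by (intro pred_intros_countable_bounded(4) pred_in_tree)
    qed
    then have "\<theta> * prob {X. immortal X}
        \<le> prob {X. \<exists>v. length v = n \<and> in_tree X v} * prob {X. immortal X}"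
      by (intro mult_right_mono) (simp_all only: Bex_def mem_Collect_eq measure_nonneg)
    also have "\<dots> \<le> prob {X. H n X}"
      unfolding H_def by (rule prob_vertex_in_generation[OF pred_immortal])
    finally show ?thesis .
  qed
  define c where "c = \<kappa> * (\<theta> * prob {X. immortal X})"
  have "c > 0" using \<kappa> \<theta> imm_pos by (simp add: c_def)
  define B where "B n X \<longleftrightarrow> immortal X \<and> H n X" for n X
  have pred_B: "Measurable.pred (ecbp lam) (B n)" for n
    unfolding B_def by (intro pred_intros_logic(3) pred_immortal pred_H)
  have B_ge: "c \<le> prob {X. B (Suc n) X}" for n
  proof -
    have "c \<le> \<kappa> * prob {X. H n X}"
      unfolding c_def using \<kappa> H_ge by (intro mult_left_mono) auto
    also have "\<dots> \<le> prob {X. immortal X \<and> (\<exists>c m. m < X ([], c) \<and> H n (subtree [(c, m)] X))}"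
      by (rule bound[OF pred_H])
    also have "\<dots> \<le> prob {X. B (Suc n) X}"
    proof (rule finite_measure_mono)
      show "{X. immortal X \<and> (\<exists>c m. m < X ([], c) \<and> H n (subtree [(c, m)] X))}
          \<subseteq> {X. B (Suc n) X}"
      proof safe
        fix X c m
        assume X: "immortal X" "m < X ([], c)" "H n (subtree [(c, m)] X)"
        then obtain v where v: "length v = n" "in_tree (subtree [(c, m)] X) v"
          "immortal (subtree v (subtree [(c, m)] X))"
          unfolding H_def by blast
        then have "H (Suc n) X"
          unfolding H_def using X(2)
          by (intro exI[of _ "v @ [(c, m)]"]) (simp add: in_tree_append subtree_subtree)
        then show "B (Suc n) X" using X(1) by (simp add: B_def)
      qed
      show "{X. B (Suc n) X} \<in> events" unfolding sets_ecbp_iff by (rule pred_B)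
    qed
    finally show ?thesis .
  qed
  \<comment> \<open>The intersection of the decreasing events \<open>?U N\<close> is the event that \<open>B n\<close> holds infinitely often.\<close>
  let ?U = "\<lambda>N. {X. \<exists>n. B (Suc (N + n)) X}"
  have U: "?U N \<in> events" for N
    unfolding sets_ecbp_iff by (intro pred_intros_countable(2) pred_B)
  have U_ge: "c \<le> prob (?U N)" for N
  proof -
    have "c \<le> prob {X. B (Suc N) X}" by (rule B_ge)
    also have "\<dots> \<le> prob (?U N)"
      by (rule finite_measure_mono) (auto intro: exI[of _ 0] U)
    finally show ?thesis .
  qed
  have "(\<lambda>N. prob (?U N)) \<longlonglongrightarrow> prob (\<Inter>N. ?U N)"
  proof (rule finite_Lim_measure_decseq)
    show "decseq ?U"
    proof (rule decseq_SucI, safe)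
      fix N X n
      assume "B (Suc (Suc N + n)) X"
      then show "\<exists>n. B (Suc (N + n)) X" by (intro exI[of _ "Suc n"]) simp
    qed
  qed (use U in auto)
  then have "c \<le> prob (\<Inter>N. ?U N)"
    by (rule LIMSEQ_le_const) (use U_ge in blast)
  also have "\<dots> \<le> prob {X. infinite (friends_of_root X)}"
  proof (rule finite_measure_mono)
    show "(\<Inter>N. ?U N) \<subseteq> {X. infinite (friends_of_root X)}"
    proof
      fix X assume X: "X \<in> (\<Inter>N. ?U N)"
      have "\<exists>v. N < length v \<and> v \<in> friends_of_root X" for N
      proof -
        from X obtain n where "B (Suc (N + n)) X" by blast
        then obtain v where "immortal X" "length v = Suc (N + n)" "in_tree X v"
          "immortal (subtree v X)"
          unfolding B_def H_def by blast
        then show ?thesis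
          using friend_if_all_survive[of X v] by (intro exI[of _ v]) (simp add: immortal_def)
      qed
      then show "X \<in> {X. infinite (friends_of_root X)}" by (simp add: infinite_friends_iff)
    qed
    show "{X. infinite (friends_of_root X)} \<in> events"
      unfolding sets_ecbp_iff by (rule pred_infinite_friends)
  qed
  finally show ?thesis using \<open>c > 0\<close> by (simp add: f_star_infinity_def)
qed

lemma f_star_infinity_zero:
  fixes lam :: "real ^ 'k::finite"
  assumes pos: "\<And>c. lam $ c > 0" and not_super: "\<not> fully_supercritical lam"
  shows "f_star_infinity lam = 0"
proof -
  interpret prob_space "ecbp lam" by (rule prob_space_ecbp)
  obtain i where i: "avoiding_mean lam i \<le> 1"
    using not_super by (auto simp: fully_supercritical_def avoiding_mean_def not_less)
  have "prob {X. infinite (friends_of_root X)} \<le> prob {X. survives X i}"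
  proof (rule finite_measure_mono)
    show "{X. infinite (friends_of_root X)} \<subseteq> {X. survives X i}"
      using finite_friends_if_not_survives by blast
    show "{X. survives X i} \<in> events"
      unfolding sets_ecbp_iff by (rule pred_survives)
  qed
  also have "\<dots> = 0" by (rule survives_null_if_not_supercritical[OF pos i])
  finally show ?thesis by (simp add: f_star_infinity_def measure_le_0_iff)
qed

theorem proposition2p17:
  fixes lam :: "real ^ 'k::finite"
  assumes "\<And>i. lam $ i > 0"
  shows "fully_supercritical lam \<longleftrightarrow> f_star_infinity lam > 0"
  using f_star_infinity_pos[of lam] f_star_infinity_zero[of lam] assms by fastforce

end
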